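(* Let $d\in\mathbb N$ and let $(c_n)_{n\ge 1}$ be a sequence of positive real numbers such that for some permutation $(c'_n)$ of $(c_n)$ the sequence $(\sqrt[d]{n}/c'_n)_{n\ge1}$ is bounded. Assume that $f:\mathbb R^d\to\mathbb R$ is Lebesgue integrable ($\int_{\mathbb R^d}|f(x)|\,dx<\infty$). Then for $\lambda$-almost every $x\in\mathbb R^d$ one has $\sum_{n=1}^\infty|f(c_nx)|<\infty$ (hence $f(c_nx)\to0$ as $n\to\infty$).
   Context: $\mathbb N=\{1,2,3,\dots\}$ and $\lambda$ is the $d$-dimensional Lebesgue measure on $\mathbb R^d$. A permutation of a sequence $(c_n)_{n\ge1}$ is a sequence $(c'_n)_{n\ge1}$ of the form $c'_n=c_{\sigma(n)}$ for a bijection $\sigma:\mathbb N\to\mathbb N$. *)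

theory Defs
  imports "HOL-Analysis.Analysis"
begin

(* Sequences (c_n) with n >= 1 are functions on nat whose value at 0 is irrelevant. *)
definition seq_permutation :: "(nat \<Rightarrow> 'a) \<Rightarrow> (nat \<Rightarrow> 'a) \<Rightarrow> bool" where
  "seq_permutation c c' \<longleftrightarrow>
     (\<exists>\<sigma>. bij_betw \<sigma> {1..} {1..} \<and> (\<forall>n\<ge>1. c' n = c (\<sigma> n)))"

end

theory Submission
  imports Defs
begin

text \<open>
  The obvious estimate \<open>\<integral> \<bar>f (c\<^sub>n x)\<bar> dx = c\<^sub>n\<^sup>-\<^sup>d \<integral> \<bar>f\<bar>\<close> only bounds the integral of the series by
  a multiple of the divergent series \<open>\<Sum> 1/n\<close>, so the series need not be integrable over the
  whole space. It is integrable over every annulus \<open>a \<le> \<bar>x\<bar> \<le> b\<close> with \<open>a > 0\<close>, and since countably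
  many annuli cover everything except the origin, this is enough.

  The reason is a change of the order of summation and integration. Substituting \<open>y = c\<^sub>n x\<close>
  turns the integral of the series over the annulus into
  \<open>\<integral> \<bar>f y\<bar> (\<Sum> c\<^sub>n\<^sup>-\<^sup>d) dy\<close>, where the inner sum runs over those \<open>n\<close> with
  \<open>\<bar>y\<bar>/b \<le> c\<^sub>n \<le> \<bar>y\<bar>/a\<close>. Each of its terms is at most \<open>(b/\<bar>y\<bar>)\<^sup>d\<close>, and there are at most
  \<open>C (\<bar>y\<bar>/a)\<^sup>d\<close> of them as soon as at most \<open>C R\<^sup>d\<close> indices satisfy \<open>c\<^sub>n \<le> R\<close>. The powers of
  \<open>\<bar>y\<bar>\<close> cancel and the inner sum is at most \<open>C (b/a)\<^sup>d\<close>, whatever \<open>y\<close> is.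

  The boundedness condition enters only through this count (\<open>card_le_of_root_bounded_permutation\<close>),
  which is blind to the order of the sequence. The estimate of the inner sum is
  \<open>suminf_inverse_power_annulus_le\<close>, the integral over an annulus is bounded in
  \<open>nn_integral_annulus_suminf_le\<close>, and \<open>AE_suminf_scaleR_finite\<close> passes to almost every point.
\<close>

text \<open>
  A permutation does not change how many terms are at most \<open>R\<close>. For the rearranged sequence,
  \<open>c' m \<le> R\<close> forces \<open>root d m \<le> K R\<close>, that is \<open>m \<le> (K R)^d\<close>.
\<close>

lemma card_le_of_root_bounded_permutation:
  fixes c c' :: "nat \<Rightarrow> real"
  assumes d: "d > 0" and pos: "\<forall>n\<ge>1. c n > 0" and perm: "seq_permutation c c'"
    and bdd: "bounded ((\<lambda>n. root d (real n) / c' n) ` {1..})"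
  obtains C where "C \<ge> 0"
    and "\<And>R. R \<ge> 0 \<Longrightarrow> finite {n. c (Suc n) \<le> R} \<and> real (card {n. c (Suc n) \<le> R}) \<le> C * R ^ d"
proof -
  obtain \<sigma> where \<sigma>: "bij_betw \<sigma> {1..} {1..}" and c': "\<And>n. n \<ge> 1 \<Longrightarrow> c' n = c (\<sigma> n)"
    using perm unfolding seq_permutation_def by auto
  obtain K where "K > 0" and K: "\<And>n. n \<ge> 1 \<Longrightarrow> \<bar>root d (real n) / c' n\<bar> \<le> K"
    using bdd unfolding bounded_pos by auto
  have c'_pos: "c' n > 0" if "n \<ge> 1" for n
    using that pos c' bij_betwE[OF \<sigma>] by auto
  have count: "finite {n. c (Suc n) \<le> R} \<and> real (card {n. c (Suc n) \<le> R}) \<le> K ^ d * R ^ d"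
    if "R \<ge> 0" for R
  proof -
    let ?N = "nat \<lfloor>(K * R) ^ d\<rfloor>"
    have KR: "(K * R) ^ d \<ge> 0"
      using \<open>K > 0\<close> that by simp
    have sub: "Suc ` {n. c (Suc n) \<le> R} \<subseteq> \<sigma> ` {1..?N}"
    proof
      fix k assume "k \<in> Suc ` {n. c (Suc n) \<le> R}"
      then have k: "k \<ge> 1" "c k \<le> R" by auto
      then obtain m where m: "m \<ge> 1" "k = \<sigma> m"
        using \<sigma> unfolding bij_betw_def by (metis atLeast_iff imageE)
      have "root d (real m) \<le> K * c' m"
        using K[OF m(1)] c'_pos[OF m(1)] by (simp add: divide_simps abs_if split: if_splits)
      also have "\<dots> \<le> K * R"
        using k m c' \<open>K > 0\<close> by simp
      finally have "root d (real m) ^ d \<le> (K * R) ^ d"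
        by (intro power_mono) (use d in \<open>auto simp: real_root_ge_zero\<close>)
      then have "real m \<le> (K * R) ^ d"
        using d by simp
      then have "m \<le> ?N"
        by (simp add: le_nat_floor)
      then show "k \<in> \<sigma> ` {1..?N}"
        using m by auto
    qed
    have fin: "finite (Suc ` {n. c (Suc n) \<le> R})"
      using sub by (rule finite_subset) simp
    have "card {n. c (Suc n) \<le> R} = card (Suc ` {n. c (Suc n) \<le> R})"
      by (simp add: card_image)
    also have "\<dots> \<le> card (\<sigma> ` {1..?N})"
      using sub by (intro card_mono) auto
    also have "\<dots> \<le> ?N"
      using card_image_le[of "{1..?N}" \<sigma>] by simp
    finally have "real (card {n. c (Suc n) \<le> R}) \<le> real ?N"
      by simp
    also have "\<dots> \<le> (K * R) ^ d"
      using KR by simp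
    finally show ?thesis
      using fin by (simp add: finite_image_iff power_mult_distrib)
  qed
  show thesis
    by (rule that[of "K ^ d"]) (use \<open>K > 0\<close> count in auto)
qed

lemma nn_integral_lebesgue_scaleR:
  fixes g :: "'a::euclidean_space \<Rightarrow> ennreal"
  assumes "r > 0" and [measurable]: "g \<in> borel_measurable lebesgue"
  shows "(\<integral>\<^sup>+x. g (r *\<^sub>R x) \<partial>lebesgue) = ennreal (inverse r ^ DIM('a)) * (\<integral>\<^sup>+x. g x \<partial>lebesgue)"
proof -
  have scale: "lebesgue = density (distr lebesgue lebesgue (\<lambda>x::'a. r *\<^sub>R x)) (\<lambda>_. ennreal (r ^ DIM('a)))"
    using assms(1) lebesgue_affine_euclidean[of "\<lambda>_::'a. r" 0]
    unfolding scaleR_scaleR[symmetric] scaleR_sum_right[symmetric] euclidean_representation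
    by simp
  have "(\<integral>\<^sup>+x. g x \<partial>lebesgue) = ennreal (r ^ DIM('a)) * (\<integral>\<^sup>+x. g (r *\<^sub>R x) \<partial>lebesgue)"
    by (subst scale) (simp add: nn_integral_density nn_integral_distr nn_integral_cmult)
  then show ?thesis
    using assms(1)
    by (simp add: mult.assoc[symmetric] ennreal_mult[symmetric] power_mult_distrib[symmetric])
qed

text \<open>
  This is where the two powers of \<open>t\<close>, which plays the part of \<open>norm y\<close>, cancel: the number of
  nonzero terms is of order at most \<open>t ^ d\<close> and each term is of order at most \<open>1 / t ^ d\<close>.
\<close>

lemma suminf_inverse_power_annulus_le:
  fixes c :: "nat \<Rightarrow> real"
  assumes ab: "0 < a" "0 < b" and t: "t \<ge> 0" and pos: "\<And>n. c n > 0" and C: "C \<ge> 0"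
    and fin: "\<And>R. R \<ge> 0 \<Longrightarrow> finite {n. c n \<le> R}"
    and count: "\<And>R. R \<ge> 0 \<Longrightarrow> real (card {n. c n \<le> R}) \<le> C * R ^ d"
  shows "(\<Sum>n. ennreal (inverse (c n) ^ d) * indicator {a..b} (t / c n)) \<le> ennreal (C * (b / a) ^ d)"
proof (cases "t = 0")
  case True
  then show ?thesis
    using ab by simp
next
  case False
  with t have t: "t > 0" by simp
  let ?S = "{n. c n \<le> t / a}"
  have "(\<Sum>n. ennreal (inverse (c n) ^ d) * indicator {a..b} (t / c n))
      = (\<Sum>n\<in>?S. ennreal (inverse (c n) ^ d) * indicator {a..b} (t / c n))"
    by (rule suminf_finite)
      (use fin[of "t / a"] t ab pos in \<open>auto simp: indicator_def field_simps\<close>)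
  also have "\<dots> \<le> (\<Sum>n\<in>?S. ennreal ((b / t) ^ d))"
  proof (rule sum_mono)
    fix n
    show "ennreal (inverse (c n) ^ d) * indicator {a..b} (t / c n) \<le> ennreal ((b / t) ^ d)"
    proof (cases "t / c n \<le> b")
      case True
      then have "inverse (c n) \<le> b / t"
        using t pos[of n] by (simp add: field_simps)
      then have "inverse (c n) ^ d \<le> (b / t) ^ d"
        using pos[of n] by (intro power_mono) (auto simp: less_imp_le)
      then show ?thesis
        by (auto simp: indicator_def intro: ennreal_leI)
    qed (simp add: indicator_def)
  qed
  also have "\<dots> = ennreal (real (card ?S) * (b / t) ^ d)"
    using t ab by (simp add: ennreal_mult ennreal_of_nat_eq_real_of_nat)
  also have "\<dots> \<le> ennreal (C * (t / a) ^ d * (b / t) ^ d)"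
    using count[of "t / a"] t ab by (intro ennreal_leI mult_right_mono) auto
  also have "C * (t / a) ^ d * (b / t) ^ d = C * (b / a) ^ d"
    using t ab by (simp add: field_simps)
  finally show ?thesis .
qed

text \<open>
  By Tonelli, the integral over the annulus becomes one of \<open>g y\<close> against the sum of the preceding
  lemma at \<open>t = norm y\<close>. The bound has no dependence on \<open>y\<close>, so only the integral of \<open>g\<close> remains.
\<close>

lemma nn_integral_annulus_suminf_le:
  fixes c :: "nat \<Rightarrow> real" and g :: "'a::euclidean_space \<Rightarrow> ennreal"
  assumes [measurable]: "g \<in> borel_measurable lebesgue"
    and ab: "0 < a" "0 < b" and pos: "\<And>n. c n > 0" and C: "C \<ge> 0"
    and fin: "\<And>R. R \<ge> 0 \<Longrightarrow> finite {n. c n \<le> R}"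
    and count: "\<And>R. R \<ge> 0 \<Longrightarrow> real (card {n. c n \<le> R}) \<le> C * R ^ DIM('a)"
  shows "(\<integral>\<^sup>+x. (\<Sum>n. g (c n *\<^sub>R x)) * indicator {a..b} (norm x) \<partial>lebesgue)
    \<le> ennreal (C * (b / a) ^ DIM('a)) * (\<integral>\<^sup>+x. g x \<partial>lebesgue)"
proof -
  have [measurable]: "(\<lambda>x::'a. indicator {a..b} (norm x / r) :: ennreal) \<in> borel_measurable lebesgue"
    for r
    by (rule measurable_completion) measurable
  have [measurable]: "(\<lambda>x::'a. g (r *\<^sub>R x)) \<in> borel_measurable lebesgue" for r
    using measurable_compose[OF lebesgue_measurable_scaling assms(1)] .
  \<comment> \<open>Written in terms of \<open>c n *\<^sub>R x\<close>, the indicator is part of the function that the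
    substitution is applied to, with a different function for each \<open>n\<close>.\<close>
  have "(\<integral>\<^sup>+x. (\<Sum>n. g (c n *\<^sub>R x)) * indicator {a..b} (norm x) \<partial>lebesgue)
      = (\<integral>\<^sup>+x. (\<Sum>n. g (c n *\<^sub>R x) * indicator {a..b} (norm (c n *\<^sub>R x) / c n)) \<partial>lebesgue)"
    using pos by (simp add: less_imp_neq[symmetric] abs_of_pos)
  also have "\<dots> = (\<Sum>n. \<integral>\<^sup>+x. g (c n *\<^sub>R x) * indicator {a..b} (norm (c n *\<^sub>R x) / c n) \<partial>lebesgue)"
    by (rule nn_integral_suminf) measurable
  also have "\<dots> = (\<Sum>n. ennreal (inverse (c n) ^ DIM('a)) *
      (\<integral>\<^sup>+x. g x * indicator {a..b} (norm x / c n) \<partial>lebesgue))"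
    by (subst nn_integral_lebesgue_scaleR[OF pos, symmetric]) auto
  also have "\<dots> = (\<integral>\<^sup>+x. (\<Sum>n. ennreal (inverse (c n) ^ DIM('a)) *
      (g x * indicator {a..b} (norm x / c n))) \<partial>lebesgue)"
    by (simp add: nn_integral_suminf nn_integral_cmult)
  also have "\<dots> = (\<integral>\<^sup>+x. (\<Sum>n. ennreal (inverse (c n) ^ DIM('a)) *
      indicator {a..b} (norm x / c n)) * g x \<partial>lebesgue)"
    by (simp add: mult_ac flip: ennreal_suminf_cmult)
  also have "\<dots> \<le> (\<integral>\<^sup>+x. ennreal (C * (b / a) ^ DIM('a)) * g x \<partial>lebesgue)"
    by (intro nn_integral_mono mult_right_mono suminf_inverse_power_annulus_le)
      (use assms in auto)
  also have "\<dots> = ennreal (C * (b / a) ^ DIM('a)) * (\<integral>\<^sup>+x. g x \<partial>lebesgue)"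
    by (simp add: nn_integral_cmult)
  finally show ?thesis .
qed

text \<open>
  Finiteness of the integral over one annulus gives convergence almost everywhere on it. The
  annuli \<open>1/k \<le> norm x \<le> k\<close> exhaust the complement of the origin, and a countable union of
  null sets is null.
\<close>

lemma AE_suminf_scaleR_finite:
  fixes c :: "nat \<Rightarrow> real" and g :: "'a::euclidean_space \<Rightarrow> ennreal"
  assumes [measurable]: "g \<in> borel_measurable lebesgue"
    and g: "(\<integral>\<^sup>+x. g x \<partial>lebesgue) < \<infinity>"
    and pos: "\<And>n. c n > 0" and C: "C \<ge> 0"
    and fin: "\<And>R. R \<ge> 0 \<Longrightarrow> finite {n. c n \<le> R}"
    and count: "\<And>R. R \<ge> 0 \<Longrightarrow> real (card {n. c n \<le> R}) \<le> C * R ^ DIM('a)"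
  shows "AE x in lebesgue. (\<Sum>n. g (c n *\<^sub>R x)) < \<infinity>"
proof -
  have [measurable]: "(\<lambda>x::'a. g (r *\<^sub>R x)) \<in> borel_measurable lebesgue" for r
    using measurable_compose[OF lebesgue_measurable_scaling assms(1)] .
  have [measurable]:
    "(\<lambda>x::'a. indicator {a..b} (norm x) :: ennreal) \<in> borel_measurable lebesgue" for a b
    by (rule measurable_completion) measurable
  have annulus: "AE x::'a in lebesgue. (\<Sum>n. g (c n *\<^sub>R x)) * indicator {a..b} (norm x) \<noteq> \<infinity>"
    if "0 < a" "0 < b" for a b
  proof (rule nn_integral_PInf_AE)
    show "(\<integral>\<^sup>+x. (\<Sum>n. g (c n *\<^sub>R x)) * indicator {a..b} (norm x) \<partial>lebesgue) \<noteq> \<infinity>"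
      using nn_integral_annulus_suminf_le[OF assms(1) that pos C fin count] g
      by (auto simp: top_unique ennreal_mult_eq_top_iff)
  qed measurable
  have "AE x::'a in lebesgue. \<forall>k. (\<Sum>n. g (c n *\<^sub>R x)) *
      indicator {inverse (real (Suc k))..real (Suc k)} (norm x) \<noteq> \<infinity>"
    unfolding AE_all_countable by (intro allI annulus) auto
  moreover have "AE x::'a in lebesgue. x \<noteq> 0"
    by (rule AE_I'[of "{0}"]) auto
  ultimately show ?thesis
  proof eventually_elim
    case (elim x)
    obtain k where k: "max (norm x) (inverse (norm x)) < real k"
      using reals_Archimedean2 by blast
    have "inverse (real (Suc k)) \<le> inverse (inverse (norm x))"
      using k elim(2) by (intro le_imp_inverse_le) auto
    with k have "norm x \<in> {inverse (real (Suc k))..real (Suc k)}"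
      by simp
    then show ?case
      using elim(1)[rule_format, of k] by (simp add: less_top)
  qed
qed

theorem theorem1:
  fixes c :: "nat \<Rightarrow> real" and f :: "real ^ 'd \<Rightarrow> real"
  assumes "\<forall>n\<ge>1. c n > 0"
    and "\<exists>c'. seq_permutation c c' \<and> bounded ((\<lambda>n. root CARD('d) (real n) / c' n) ` {1..})"
    and "integrable lebesgue f"
  shows "AE x in lebesgue.
           summable (\<lambda>n. \<bar>f (c (Suc n) *\<^sub>R x)\<bar>) \<and> (\<lambda>n. f (c n *\<^sub>R x)) \<longlonglongrightarrow> 0"
proof -
  obtain C where "C \<ge> 0" and C: "\<And>R. R \<ge> 0 \<Longrightarrow>
      finite {n. c (Suc n) \<le> R} \<and> real (card {n. c (Suc n) \<le> R}) \<le> C * R ^ CARD('d)"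
    using assms(2) card_le_of_root_bounded_permutation[OF zero_less_card_finite assms(1)] by metis
  have "AE x in lebesgue. (\<Sum>n. ennreal \<bar>f (c (Suc n) *\<^sub>R x)\<bar>) < \<infinity>"
  proof (rule AE_suminf_scaleR_finite)
    show "(\<integral>\<^sup>+x. ennreal \<bar>f x\<bar> \<partial>lebesgue) < \<infinity>"
      using assms(3) by (simp add: integrable_iff_bounded)
  qed (use assms C \<open>C \<ge> 0\<close> in auto)
  then show ?thesis
  proof eventually_elim
    case (elim x)
    then have sum: "summable (\<lambda>n. \<bar>f (c (Suc n) *\<^sub>R x)\<bar>)"
      by (intro summable_suminf_not_top) auto
    have "(\<lambda>n. f (c (Suc n) *\<^sub>R x)) \<longlonglongrightarrow> 0"
      using summable_LIMSEQ_zero[OF sum] by (rule tendsto_rabs_zero_cancel)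
    then have "(\<lambda>n. f (c n *\<^sub>R x)) \<longlonglongrightarrow> 0"
      by (rule LIMSEQ_imp_Suc)
    with sum show ?case by simp
  qed
qed

end
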